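(* If $H$ is a solvable subgroup of $PL_o(I)$, then $H$ is countable.
   Context: $PL_o(I)$ is the group, under composition, of orientation-preserving piecewise-linear homeomorphisms of the unit interval $I=[0,1]$ with finitely many breaks in slope. *)

theory Defs
  imports "HOL-Analysis.Analysis" "HOL-Algebra.Bij" "HOL-Algebra.Solvable_Groups"
begin

text \<open>The finite set \<open>B\<close> contains the breaks: the function is affine on every closed subinterval
  whose interior avoids \<open>B\<close>. The set \<open>B\<close> need not be minimal.\<close>

definition piecewise_linear :: "real \<Rightarrow> real \<Rightarrow> (real \<Rightarrow> real) \<Rightarrow> bool" where
  "piecewise_linear p q f \<longleftrightarrow>
     (\<exists>B. finite B \<and>
        (\<forall>x y. p \<le> x \<and> x \<le> y \<and> y \<le> q \<and> {x<..<y} \<inter> B = {} \<longrightarrow>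
           (\<exists>a b. \<forall>t\<in>{x..y}. f t = a * t + b)))"

text \<open>Elements are extensional functions (value \<open>undefined\<close> outside the interval), so that two
  homeomorphisms are equal iff they agree on the unit interval; this makes them elements of the
  group \<open>BijGroup {0..1}\<close>, whose product is composition.\<close>

definition PLo_homeos :: "(real \<Rightarrow> real) set" where
  "PLo_homeos = {f \<in> extensional {0..1}.
     (\<exists>g. homeomorphism {0..1} {0..1} f g) \<and> strict_mono_on {0..1} f \<and> piecewise_linear 0 1 f}"

definition PLo :: "(real \<Rightarrow> real) monoid" where
  "PLo = (BijGroup {0..1}) \<lparr>carrier := PLo_homeos\<rparr>"

lemma PLo_homeos_subset_Bij: "PLo_homeos \<subseteq> Bij {0..1}"
  unfolding PLo_homeos_def Bij_def bij_betw_def homeomorphism_def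
  by (auto simp: strict_mono_on_imp_inj_on)

lemma PLo_homeos_id: "(\<lambda>x\<in>{0..1}. x) \<in> PLo_homeos"
proof -
  have "homeomorphism {0..1} {0..1} (\<lambda>x\<in>{0..1::real}. x) (\<lambda>x. x)"
    by (rule homeomorphism_cong[OF homeomorphism_ident]) auto
  moreover have "piecewise_linear 0 1 (\<lambda>x\<in>{0..1}. x)"
    unfolding piecewise_linear_def
    by (intro exI[of _ "{}"] conjI allI impI exI[of _ 1] exI[of _ 0]) auto
  ultimately show ?thesis
    unfolding PLo_homeos_def by (auto simp: strict_mono_on_def)
qed

lemma piecewise_linearE:
  assumes "piecewise_linear p q f"
  obtains B where "finite B" "\<And>x y. \<lbrakk>p \<le> x; x \<le> y; y \<le> q; {x<..<y} \<inter> B = {}\<rbrakk>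
      \<Longrightarrow> \<exists>a b. \<forall>t\<in>{x..y}. f t = a * t + b"
proof -
  obtain B where fin: "finite B"
    and B: "\<forall>x y. p \<le> x \<and> x \<le> y \<and> y \<le> q \<and> {x<..<y} \<inter> B = {} \<longrightarrow>
      (\<exists>a b. \<forall>t\<in>{x..y}. f t = a * t + b)"
    using assms unfolding piecewise_linear_def by (elim exE conjE)
  show thesis
  proof (rule that[OF fin])
    fix x y assume "p \<le> x" "x \<le> y" "y \<le> q" "{x<..<y} \<inter> B = {}"
    then show "\<exists>a b. \<forall>t\<in>{x..y}. f t = a * t + b"
      by (intro B[rule_format] conjI)
  qed
qed

lemma piecewise_linear_compose:
  assumes f: "bij_betw f {0..1} {0..1}" "strict_mono_on {0..1} f" "piecewise_linear 0 1 f"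
    and g: "piecewise_linear 0 1 g"
  shows "piecewise_linear 0 1 (compose {0..1} g f)"
proof -
  obtain B where B: "finite B" "\<And>x y. \<lbrakk>0 \<le> x; x \<le> y; y \<le> 1; {x<..<y} \<inter> B = {}\<rbrakk>
      \<Longrightarrow> \<exists>a b. \<forall>t\<in>{x..y}. f t = a * t + b"
    by (rule piecewise_linearE[OF f(3)]) (rule that; blast)
  obtain C where C: "finite C" "\<And>x y. \<lbrakk>0 \<le> x; x \<le> y; y \<le> 1; {x<..<y} \<inter> C = {}\<rbrakk>
      \<Longrightarrow> \<exists>a b. \<forall>t\<in>{x..y}. g t = a * t + b"
    by (rule piecewise_linearE[OF g]) (rule that; blast)
  let ?D = "B \<union> (f -` C \<inter> {0..1})"
  have inj: "inj_on f {0..1}" and im: "f ` {0..1} = {0..1}"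
    using f(1) by (auto simp: bij_betw_def)
  have mono: "s \<le> t \<longleftrightarrow> f s \<le> f t" if "s \<in> {0..1}" "t \<in> {0..1}" for s t
    using strict_mono_on_less_eq[OF f(2)] that by blast
  have "\<exists>a b. \<forall>t\<in>{x..y}. compose {0..1} g f t = a * t + b"
    if xy: "0 \<le> x" "x \<le> y" "y \<le> 1" "{x<..<y} \<inter> ?D = {}" for x y
  proof -
    have "{x<..<y} \<inter> B = {}" using xy by blast
    from B(2)[OF xy(1-3) this] obtain a b where ab: "\<And>t. t \<in> {x..y} \<Longrightarrow> f t = a * t + b" by blast
    have fx: "0 \<le> f x" "f x \<le> 1" "0 \<le> f y" "f y \<le> 1" using im xy by auto
    have "{f x<..<f y} \<inter> C = {}"
    proof (rule ccontr)
      assume "\<not> ?thesis"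
      then obtain c where c: "f x < c" "c < f y" "c \<in> C" by auto
      then have "c \<in> f ` {0..1}" unfolding im using fx by auto
      then obtain t where t: "t \<in> {0..1}" "c = f t" by blast
      have "x < t" "t < y"
        using mono[of t x] mono[of y t] t c xy by auto
      then show False using t c xy by auto
    qed
    moreover have "f x \<le> f y" using mono[of x y] xy by auto
    ultimately obtain a' b' where ab': "\<And>t. t \<in> {f x..f y} \<Longrightarrow> g t = a' * t + b'"
      using C(2)[of "f x" "f y"] fx by blast
    have "compose {0..1} g f t = (a' * a) * t + (a' * b + b')" if t: "t \<in> {x..y}" for t
    proof -
      have "f t \<in> {f x..f y}" using mono[of x t] mono[of t y] t xy by auto
      then have "g (f t) = a' * (a * t + b) + b'" using ab' ab[OF t] by simp
      then show ?thesis using t xy by (simp add: compose_def algebra_simps)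
    qed
    then show ?thesis by blast
  qed
  moreover have "finite ?D" using B(1) C(1) finite_vimage_IntI[OF C(1) inj] by blast
  ultimately show ?thesis
    unfolding piecewise_linear_def by (intro exI[of _ "?D"]) simp
qed

lemma piecewise_linear_inverse:
  assumes f: "bij_betw f {0..1} {0..1}" "strict_mono_on {0..1} f" "piecewise_linear 0 1 f"
    and g: "\<And>s. s \<in> {0..1} \<Longrightarrow> g s \<in> {0..1} \<and> f (g s) = s"
  shows "piecewise_linear 0 1 g"
proof -
  obtain B where B: "finite B" "\<And>x y. \<lbrakk>0 \<le> x; x \<le> y; y \<le> 1; {x<..<y} \<inter> B = {}\<rbrakk>
      \<Longrightarrow> \<exists>a b. \<forall>t\<in>{x..y}. f t = a * t + b"
    by (rule piecewise_linearE[OF f(3)]) (rule that; blast)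
  have less: "f s < f t \<longleftrightarrow> s < t" if "s \<in> {0..1}" "t \<in> {0..1}" for s t
    using strict_mono_on_less[OF f(2)] that by blast
  have "\<exists>a b. \<forall>s\<in>{x..y}. g s = a * s + b"
    if xy: "0 \<le> x" "x \<le> y" "y \<le> 1" "{x<..<y} \<inter> f ` B = {}" for x y
  proof (cases "x = y")
    case True
    then show ?thesis by (intro exI[of _ 0] exI[of _ "g x"]) auto
  next
    case False
    have g01: "g x \<in> {0..1}" "f (g x) = x" "g y \<in> {0..1}" "f (g y) = y" using g xy by auto
    have "x < y" using False xy by simp
    then have lt: "g x < g y" using less[OF g01(1) g01(3)] unfolding g01(2,4) by blast
    have "{g x<..<g y} \<inter> B = {}"
    proof (rule ccontr)
      assume "\<not> ?thesis"
      then obtain t where t: "g x < t" "t < g y" "t \<in> B" by auto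
      then have "x < f t" "f t < y" using less[of "g x" t] less[of t "g y"] g01 by auto
      then show False using t xy by auto
    qed
    with B(2)[of "g x" "g y"] lt g01 obtain a b
      where ab: "\<And>t. t \<in> {g x..g y} \<Longrightarrow> f t = a * t + b" by auto
    have "x = a * g x + b" "y = a * g y + b" using ab[of "g x"] ab[of "g y"] g01 lt by auto
    then have a: "a \<noteq> 0" using False by auto
    have "g s = (1 / a) * s + (- b / a)" if s: "s \<in> {x..y}" for s
    proof -
      have gs: "g s \<in> {0..1}" "f (g s) = s" using g[of s] s xy by auto
      have "g s \<in> {g x..g y}"
        using less[of "g s" "g x"] less[of "g y" "g s"] gs g01 s by auto
      then have "s = a * g s + b" using ab gs by metis
      then show ?thesis using a by (simp add: field_simps)
    qed
    then show ?thesis by blast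
  qed
  moreover have "finite (f ` B)" using B(1) by blast
  ultimately show ?thesis
    unfolding piecewise_linear_def by (intro exI[of _ "f ` B"]) simp
qed

lemma PLo_homeos_compose:
  assumes "g \<in> PLo_homeos" "f \<in> PLo_homeos"
  shows "compose {0..1} g f \<in> PLo_homeos"
proof -
  obtain f' g' where "homeomorphism {0..1} {0..1} f f'" "homeomorphism {0..1} {0..1} g g'"
    using assms unfolding PLo_homeos_def by blast
  then have "homeomorphism {0..1} {0..1} (g \<circ> f) (f' \<circ> g')"
    by (rule homeomorphism_compose)
  then have "homeomorphism {0..1} {0..1} (compose {0..1} g f) (f' \<circ> g')"
    by (rule homeomorphism_cong) (auto simp: compose_def)
  moreover have bij: "bij_betw f {0..1} {0..1}"
    using assms PLo_homeos_subset_Bij by (auto simp: Bij_def)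
  moreover have "strict_mono_on {0..1} (compose {0..1} g f)"
  proof (rule strict_mono_onI)
    fix r s :: real assume rs: "r \<in> {0..1}" "s \<in> {0..1}" "r < s"
    have "strict_mono_on {0..1} f" "strict_mono_on {0..1} g"
      using assms unfolding PLo_homeos_def by auto
    moreover have "f r \<in> {0..1}" "f s \<in> {0..1}"
      using bij_betwE[OF bij] rs by blast+
    ultimately have "g (f r) < g (f s)"
      using rs strict_mono_onD by metis
    then show "compose {0..1} g f r < compose {0..1} g f s"
      using rs by (simp add: compose_def)
  qed
  ultimately show ?thesis
    using assms piecewise_linear_compose[OF bij] unfolding PLo_homeos_def by auto
qed

lemma PLo_homeos_inverse:
  assumes f: "f \<in> PLo_homeos"
  shows "(\<lambda>x\<in>{0..1}. inv_into {0..1} f x) \<in> PLo_homeos" (is "?g \<in> _")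
proof -
  have bij: "bij_betw f {0..1} {0..1}"
    using assms PLo_homeos_subset_Bij by (auto simp: Bij_def)
  have g: "?g s \<in> {0..1} \<and> f (?g s) = s" if "s \<in> {0..1}" for s
    using that bij bij_betw_inv_into_right[OF bij that] bij_betwE[OF bij_betw_inv_into[OF bij]]
    by auto
  obtain h where h: "homeomorphism {0..1} {0..1} f h"
    using assms unfolding PLo_homeos_def by blast
  have "h s = ?g s" if s: "s \<in> {0..1}" for s
  proof -
    have "h (f (?g s)) = ?g s" using h g[OF s] unfolding homeomorphism_def by blast
    then show ?thesis using g[OF s] by simp
  qed
  then have "homeomorphism {0..1} {0..1} ?g f"
    by (intro homeomorphism_cong[OF homeomorphism_symD[OF h]]) simp_all
  moreover have sm: "strict_mono_on {0..1} f" and pl: "piecewise_linear 0 1 f"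
    using f unfolding PLo_homeos_def by auto
  moreover have "strict_mono_on {0..1} ?g"
  proof (rule strict_mono_onI)
    fix r s :: real assume "r \<in> {0..1}" "s \<in> {0..1}" "r < s"
    then show "?g r < ?g s"
      using strict_mono_on_less[OF sm, of "?g r" "?g s"] g[of r] g[of s] by metis
  qed
  moreover have "piecewise_linear 0 1 ?g"
    using piecewise_linear_inverse[OF bij sm pl g] by blast
  ultimately show ?thesis unfolding PLo_homeos_def by blast
qed

lemma subgroup_PLo_homeos: "subgroup PLo_homeos (BijGroup {0..1})"
proof (rule group.subgroupI[OF group_BijGroup])
  show "PLo_homeos \<subseteq> carrier (BijGroup {0..1})"
    using PLo_homeos_subset_Bij by (simp add: BijGroup_def)
  show "PLo_homeos \<noteq> {}" using PLo_homeos_id by blast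
  fix f g assume fg: "f \<in> PLo_homeos"
  then have "inv\<^bsub>BijGroup {0..1}\<^esub> f = (\<lambda>x\<in>{0..1}. inv_into {0..1} f x)"
    using inv_BijGroup PLo_homeos_subset_Bij by blast
  then show "inv\<^bsub>BijGroup {0..1}\<^esub> f \<in> PLo_homeos"
    using PLo_homeos_inverse[OF fg] by simp
  assume "g \<in> PLo_homeos"
  then show "f \<otimes>\<^bsub>BijGroup {0..1}\<^esub> g \<in> PLo_homeos"
    using PLo_homeos_compose fg PLo_homeos_subset_Bij by (auto simp: BijGroup_def subset_iff)
qed

lemma group_PLo: "group PLo"
  unfolding PLo_def
  by (rule group.subgroup_imp_group[OF group_BijGroup subgroup_PLo_homeos])

end

theory Submission
  imports Defs
begin

text \<open>The derived series of a solvable group ends in the trivial group, so it suffices to climb it one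
step: a group \<open>G\<close> of piecewise linear homeomorphisms whose commutators form a countable set is
itself countable (\<open>countable_if_countable_commutators\<close>). Extending the homeomorphisms by the
identity makes them compactly supported homeomorphisms of the line, where composition and inverse
are those of functions.

The first ingredient is that centralizers are small where the centralized map moves points. On
an interval \<open>(a,b)\<close> between consecutive fixed points of \<open>f\<close>, a map commuting with \<open>f\<close> is
determined by its value at a single point, because the iterates of \<open>f\<close> carry every point into
the region next to \<open>a\<close> where the map is affine. Moreover such a map carries some break of an
iterate of \<open>f\<close> to a break of the same iterate, and there are only countably many pairs of such
breaks. Hence the maps commuting with \<open>f\<close> have only countably many restrictions to \<open>(a,b)\<close>
(\<open>countable_restrictions_of_centralizer\<close>).

Now let the commutators of \<open>G\<close> be countable and let \<open>f\<close> be in \<open>G\<close>. Two elements of \<open>G\<close> with the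
same commutator with \<open>f\<close> differ by a factor commuting with \<open>f\<close>, so the centralizer of \<open>f\<close> has
countable index and \<open>G\<close> itself has only countably many restrictions to \<open>(a,b)\<close>. By the
Lindeloef property countably many such intervals cover all points moved by \<open>G\<close>, and so only
countably many moved points are breaks of elements of \<open>G\<close>. A break that no element moves is an
end of an interval of moved points, and there are countably many of these as well. Each point has
a countable orbit, and an element is determined by its finitely many breaks together with its
values there. Therefore \<open>G\<close> is countable.\<close>

section \<open>Breaks of piecewise linear homeomorphisms of the line\<close>

definition affine_near :: "(real \<Rightarrow> real) \<Rightarrow> real \<Rightarrow> bool" where
  "affine_near f x \<longleftrightarrow> (\<exists>a b. \<forall>\<^sub>F t in nhds x. f t = a * t + b)"

text \<open>Breaks are defined by the germ of the function and not by a chosen subdivision,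
so that composition with homeomorphisms transports them.\<close>

definition breaks :: "(real \<Rightarrow> real) \<Rightarrow> real set" where
  "breaks f = {x. \<not> affine_near f x}"

definition moved :: "(real \<Rightarrow> real) \<Rightarrow> real set" where
  "moved f = {x. f x \<noteq> x}"

text \<open>The group of compactly supported piecewise linear homeomorphisms of the line.
Continuity follows from monotonicity and surjectivity.\<close>

definition PLc :: "(real \<Rightarrow> real) set" where
  "PLc = {f. strict_mono f \<and> surj f \<and> finite (breaks f) \<and> bounded (moved f)}"

lemma affine_near_cong:
  assumes "\<forall>\<^sub>F t in nhds x. f t = g t" "affine_near g x"
  shows "affine_near f x"
proof -
  obtain a b where "\<forall>\<^sub>F t in nhds x. g t = a * t + b"
    using assms(2) unfolding affine_near_def by blast
  with assms(1) have "\<forall>\<^sub>F t in nhds x. f t = a * t + b"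
    by eventually_elim simp
  then show ?thesis unfolding affine_near_def by blast
qed

lemma affine_germ_unique:
  fixes a b a' b' x :: real
  assumes "\<forall>\<^sub>F t in nhds x. a * t + b = a' * t + b'"
  shows "a = a' \<and> b = b'"
proof -
  obtain d where d: "d > 0" "\<And>t. dist t x < d \<Longrightarrow> a * t + b = a' * t + b'"
    using assms unfolding eventually_nhds_metric by blast
  have 1: "a * x + b = a' * x + b'" using d by simp
  have 2: "a * (x + d/2) + b = a' * (x + d/2) + b'" using d by (simp add: dist_real_def)
  from 1 2 have "(a - a') * (d/2) = 0" unfolding distrib_left left_diff_distrib by linarith
  then have "a = a'" using d(1) by simp
  then show ?thesis using 1 by simp
qed

text \<open>The coefficients of the germ are locally constant, hence constant by connectedness of
the interval; continuity extends the formula to the end points.\<close>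

lemma affine_between_breaks:
  assumes cont: "continuous_on {u..v} f" and uv: "u < v" and nb: "breaks f \<inter> {u<..<v} = {}"
  obtains a b where "\<And>t. t \<in> {u..v} \<Longrightarrow> f t = a * t + b"
proof -
  let ?c = "(u + v) / 2"
  have c: "?c \<in> {u<..<v}" using uv by auto
  have aff: "affine_near f x" if "x \<in> {u<..<v}" for x
    using nb that unfolding breaks_def by blast
  obtain a b where ab: "\<forall>\<^sub>F t in nhds ?c. f t = a * t + b"
    using aff[OF c] unfolding affine_near_def by blast
  have germ: "\<forall>\<^sub>F t in nhds y. f t = a * t + b" if y: "y \<in> {u<..<v}" for y
  proof (rule connected_induction_simple[of "{u<..<v}" ?c y "\<lambda>y. \<forall>\<^sub>F t in nhds y. f t = a * t + b"])
    fix x assume x: "x \<in> {u<..<v}"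
    obtain a' b' where "\<forall>\<^sub>F t in nhds x. f t = a' * t + b'"
      using aff[OF x] unfolding affine_near_def by blast
    then obtain T where T: "open T" "x \<in> T" "\<And>t. t \<in> T \<Longrightarrow> f t = a' * t + b'"
      unfolding eventually_nhds by blast
    let ?T = "{u<..<v} \<inter> T"
    have germT: "\<forall>\<^sub>F t in nhds z. f t = a' * t + b'" if "z \<in> T" for z
      using T that unfolding eventually_nhds by blast
    have "\<forall>\<^sub>F t in nhds w. f t = a * t + b"
      if z: "z \<in> ?T" "\<forall>\<^sub>F t in nhds z. f t = a * t + b" and w: "w \<in> ?T" for z w
    proof -
      have "\<forall>\<^sub>F t in nhds z. a * t + b = a' * t + b'"
        using z(2) germT[of z] z(1) by (auto elim: eventually_elim2)
      then have "a = a'" "b = b'" using affine_germ_unique by blast+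
      then show ?thesis using germT[of w] w by simp
    qed
    moreover have "openin (top_of_set {u<..<v}) ?T" using T(1) by (rule openin_open_Int)
    ultimately show "\<exists>T. openin (top_of_set {u<..<v}) T \<and> x \<in> T \<and>
        (\<forall>z\<in>T. \<forall>w\<in>T. (\<forall>\<^sub>F t in nhds z. f t = a * t + b) \<longrightarrow> (\<forall>\<^sub>F t in nhds w. f t = a * t + b))"
      using x T(2) by (intro exI[of _ ?T]) blast
  qed (use c y ab in auto)
  have open_eq: "f t = a * t + b" if "t \<in> {u<..<v}" for t
    using eventually_nhds_x_imp_x[OF germ[OF that]] .
  have "f t - (a * t + b) = 0" if t: "t \<in> {u..v}" for t
  proof (rule continuous_constant_on_closure[of "{u<..<v}" "\<lambda>t. f t - (a * t + b)" 0])
    show "continuous_on (closure {u<..<v}) (\<lambda>t. f t - (a * t + b))"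
      using cont uv by (auto intro!: continuous_intros)
  qed (use open_eq t uv in auto)
  then show thesis using that by (metis eq_iff_diff_eq_0)
qed

lemma PLc_strict_mono: "f \<in> PLc \<Longrightarrow> strict_mono f"
  and PLc_surj: "f \<in> PLc \<Longrightarrow> surj f"
  and PLc_finite_breaks: "f \<in> PLc \<Longrightarrow> finite (breaks f)"
  and PLc_bounded: "f \<in> PLc \<Longrightarrow> bounded (moved f)"
  by (auto simp: PLc_def)

lemma strict_mono_surj_continuous:
  fixes f :: "real \<Rightarrow> real"
  assumes "strict_mono f" "surj f"
  shows "continuous_on A f"
proof (rule continuous_on_subset[of UNIV])
  show "continuous_on UNIV f"
    using assms by (intro continuous_onI_mono) (auto simp: strict_mono_less_eq)
qed simp

lemma PLc_continuous: "f \<in> PLc \<Longrightarrow> continuous_on A f"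
  by (simp add: PLc_def strict_mono_surj_continuous)

lemma PLc_bij: "f \<in> PLc \<Longrightarrow> bij f"
  by (simp add: PLc_def bij_def strict_mono_imp_inj_on)

lemma PLc_less: "f \<in> PLc \<Longrightarrow> f x < f y \<longleftrightarrow> x < y"
  by (simp add: PLc_def strict_mono_less)

lemma open_moved: "f \<in> PLc \<Longrightarrow> open (moved f)"
  unfolding moved_def by (intro open_Collect_neq PLc_continuous continuous_on_id)

lemma affine_near_comp:
  assumes "affine_near f x" "affine_near g (f x)"
  shows "affine_near (g \<circ> f) x"
proof -
  obtain a b where ab: "\<forall>\<^sub>F t in nhds x. f t = a * t + b"
    using assms(1) unfolding affine_near_def by blast
  obtain a' b' where ab': "\<forall>\<^sub>F t in nhds (f x). g t = a' * t + b'"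
    using assms(2) unfolding affine_near_def by blast
  have fx: "f x = a * x + b" using eventually_nhds_x_imp_x[OF ab] .
  have "((\<lambda>t. a * t + b) \<longlongrightarrow> a * x + b) (nhds x)"
    by (intro tendsto_intros filterlim_ident)
  then have "(f \<longlongrightarrow> f x) (nhds x)"
    unfolding fx by (subst tendsto_cong[OF ab])
  then have "\<forall>\<^sub>F t in nhds x. g (f t) = a' * f t + b'"
    using ab' filterlim_iff by blast
  with ab have "\<forall>\<^sub>F t in nhds x. (g \<circ> f) t = (a' * a) * t + (a' * b + b')"
    by eventually_elim (simp add: algebra_simps)
  then show ?thesis unfolding affine_near_def by blast
qed

text \<open>The inverse under composition, as opposed to the inverse \<open>inv\<close> in a group.\<close>

abbreviation fun_inv :: "(real \<Rightarrow> real) \<Rightarrow> real \<Rightarrow> real" where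
  "fun_inv f \<equiv> inv_into UNIV f"

lemma strict_mono_surj_inv:
  fixes f :: "real \<Rightarrow> real"
  assumes "strict_mono f" "surj f"
  shows "strict_mono (fun_inv f)" "surj (fun_inv f)" "fun_inv f (f x) = x" "f (fun_inv f x) = x"
proof -
  have inj: "inj f" using assms(1) by (rule strict_mono_imp_inj_on)
  show "strict_mono (fun_inv f)"
  proof (rule strict_monoI)
    fix s t :: real assume "s < t"
    then have "f (fun_inv f s) < f (fun_inv f t)" using assms(2) by (simp add: surj_f_inv_f)
    then show "fun_inv f s < fun_inv f t" using strict_mono_less[OF assms(1)] by blast
  qed
  show "surj (fun_inv f)" using inj by (rule inj_imp_surj_inv)
  show "fun_inv f (f x) = x" using inj by simp
  show "f (fun_inv f x) = x" using assms(2) by (rule surj_f_inv_f)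
qed

lemma affine_near_inv:
  assumes f: "strict_mono f" "surj f" and x: "affine_near f x"
  shows "affine_near (fun_inv f) (f x)"
proof -
  obtain a b where ab: "\<forall>\<^sub>F t in nhds x. f t = a * t + b"
    using x unfolding affine_near_def by blast
  then obtain d where d: "d > 0" "\<And>t. dist t x < d \<Longrightarrow> f t = a * t + b"
    unfolding eventually_nhds_metric by blast
  have "f x \<noteq> f (x + d/2)" using d(1) f(1) by (simp add: strict_mono_eq)
  then have a: "a \<noteq> 0" using d(2)[of x] d(2)[of "x + d/2"] d(1) by (auto simp: dist_real_def)
  have "isCont (fun_inv f) (f x)"
    using strict_mono_surj_continuous[of "fun_inv f" UNIV] strict_mono_surj_inv[OF f]
    by (simp add: continuous_on_eq_continuous_at)
  then have "(fun_inv f \<longlongrightarrow> x) (nhds (f x))"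
    using tendsto_at_iff_tendsto_nhds[of "fun_inv f" "f x"] strict_mono_surj_inv(3)[OF f]
    by (simp add: isCont_def)
  then have "\<forall>\<^sub>F s in nhds (f x). f (fun_inv f s) = a * fun_inv f s + b"
    using ab filterlim_iff by blast
  then have "\<forall>\<^sub>F s in nhds (f x). fun_inv f s = (1/a) * s + (- b/a)"
    by eventually_elim (use a in \<open>simp add: strict_mono_surj_inv(4)[OF f] field_simps\<close>)
  then show ?thesis unfolding affine_near_def by blast
qed

lemma PLc_inv:
  assumes f: "f \<in> PLc"
  shows "fun_inv f \<in> PLc"
proof -
  note sm = PLc_strict_mono[OF f] PLc_surj[OF f]
  have "breaks (fun_inv f) \<subseteq> f ` breaks f"
  proof
    fix y assume y: "y \<in> breaks (fun_inv f)"
    have fy: "f (fun_inv f y) = y" by (rule strict_mono_surj_inv(4)[OF sm])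
    then have "fun_inv f y \<in> breaks f"
      using affine_near_inv[OF sm, of "fun_inv f y"] y unfolding breaks_def by auto
    then show "y \<in> f ` breaks f" using fy by (metis imageI)
  qed
  then have "finite (breaks (fun_inv f))"
    using PLc_finite_breaks[OF f] finite_surj by blast
  moreover have "moved (fun_inv f) = moved f"
    using strict_mono_surj_inv(3,4)[OF sm] unfolding moved_def by (metis (lifting))
  ultimately show ?thesis
    using strict_mono_surj_inv(1,2)[OF sm] PLc_bounded[OF f] by (simp add: PLc_def)
qed

lemma PLc_funpow_breaks:
  assumes f: "f \<in> PLc"
  shows "finite (breaks (f ^^ n))"
proof (induction n)
  case 0
  have "affine_near (f ^^ 0) x" for x
    unfolding affine_near_def by (intro exI[of _ 1] exI[of _ 0]) simp
  then have "breaks (f ^^ 0) = {}" unfolding breaks_def by blast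
  then show ?case by (simp only: finite.emptyI)
next
  case (Suc n)
  have "breaks (f ^^ Suc n) \<subseteq> breaks f \<union> f -` breaks (f ^^ n)"
    unfolding breaks_def using affine_near_comp[of f _ "f ^^ n"] by (auto simp: funpow_Suc_right simp del: funpow.simps)
  moreover have "finite (f -` breaks (f ^^ n))"
    using Suc PLc_bij[OF f] by (intro finite_vimageI bij_is_inj)
  ultimately show ?case using PLc_finite_breaks[OF f] finite_subset by blast
qed

section \<open>Centralizers\<close>

text \<open>The iterates decrease to a fixed point of \<open>f\<close>, and \<open>a\<close> is the only one below \<open>b\<close> that
they can reach.\<close>

lemma iterates_tendsto:
  fixes f :: "real \<Rightarrow> real"
  assumes f: "f \<in> PLc" "f a = a" and dec: "\<And>y. y \<in> {a<..<b} \<Longrightarrow> f y < y" and x: "x \<in> {a<..<b}"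
  shows "(f ^^ n) x \<in> {a<..<b}" and "(\<lambda>n. (f ^^ n) x) \<longlonglongrightarrow> a"
proof -
  have in_orb: "(f ^^ n) x \<in> {a<..<b}" for n
  proof (induction n)
    case (Suc n)
    then show ?case using dec[OF Suc] PLc_less[OF f(1), of a "(f ^^ n) x"] f(2) by auto
  qed (use x in simp)
  then show "(f ^^ n) x \<in> {a<..<b}" .
  have decr: "decseq (\<lambda>n. (f ^^ n) x)"
    using dec[OF in_orb] by (intro decseq_SucI) (simp add: less_imp_le)
  obtain L where L: "(\<lambda>n. (f ^^ n) x) \<longlonglongrightarrow> L" "\<And>n. L \<le> (f ^^ n) x"
    using decseq_convergent[OF decr, of a] in_orb by (metis greaterThanLessThan_iff less_imp_le)
  have "isCont f L"
    using PLc_continuous[OF f(1), of UNIV] by (simp add: continuous_on_eq_continuous_at)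
  then have "(\<lambda>n. f ((f ^^ n) x)) \<longlonglongrightarrow> f L" by (rule isCont_tendsto_compose) (rule L(1))
  moreover have "(\<lambda>n. f ((f ^^ n) x)) \<longlonglongrightarrow> L" using LIMSEQ_Suc[OF L(1)] by simp
  ultimately have "f L = L" by (rule LIMSEQ_unique)
  moreover have "a \<le> L" using L(1) in_orb by (intro LIMSEQ_le_const) (auto intro: less_imp_le)
  moreover have "L < b" using L(2)[of 0] x by simp
  ultimately have "L = a" using dec[of L] by force
  then show "(\<lambda>n. (f ^^ n) x) \<longlonglongrightarrow> a" using L(1) by simp
qed

lemma commute_funpow:
  assumes "k \<circ> f = f \<circ> k"
  shows "k ((f ^^ n) x) = (f ^^ n) (k x)"
  using assms by (induction n) (auto simp: fun_eq_iff)

lemma finite_gap: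
  fixes a :: real
  assumes "finite S"
  obtains d where "d > 0" "S \<inter> {a<..<a + d} = {}" "S \<inter> {a - d<..<a} = {}"
proof -
  obtain d where "d > 0" "\<forall>x\<in>S. x \<noteq> a \<longrightarrow> d \<le> dist a x"
    using finite_set_avoid[OF assms] by blast
  then show thesis by (intro that[of d]) (force simp: dist_real_def)+
qed

text \<open>The maps \<open>k\<close> and \<open>h\<close> agree along the orbit of \<open>x\<close>, which tends to \<open>a\<close>. Close to \<open>a\<close> both are
affine, so they agree near \<open>a\<close>; an iterate of \<open>f\<close> brings \<open>y\<close> there. The argument
also covers maps that carry the interval onto a different one.\<close>

lemma commuting_determined_by_one_value:
  assumes f: "f \<in> PLc" "f a = a" and dec: "\<And>y. y \<in> {a<..<b} \<Longrightarrow> f y < y"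
    and k: "k \<in> PLc" "k \<circ> f = f \<circ> k" and h: "h \<in> PLc" "h \<circ> f = f \<circ> h"
    and x: "x \<in> {a<..<b}" "k x = h x" and y: "y \<in> {a<..<b}"
  shows "k y = h y"
proof -
  note it = iterates_tendsto[OF f dec]
  have cont: "isCont k a" "isCont h a"
    using PLc_continuous[OF k(1), of UNIV] PLc_continuous[OF h(1), of UNIV]
    by (simp_all add: continuous_on_eq_continuous_at)
  have eq: "k ((f ^^ n) x) = h ((f ^^ n) x)" for n
    using commute_funpow[OF k(2)] commute_funpow[OF h(2)] x(2) by simp
  have a: "k a = h a"
    using isCont_tendsto_compose[OF cont(1) it(2)[OF _ x(1)]]
      isCont_tendsto_compose[OF cont(2) it(2)[OF _ x(1)]]
    unfolding eq by (rule LIMSEQ_unique) auto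
  obtain d where d: "d > 0" "(breaks k \<union> breaks h) \<inter> {a<..<a + d} = {}"
    using finite_gap[of "breaks k \<union> breaks h" a] PLc_finite_breaks k(1) h(1) by (metis finite_UnI)
  obtain m c where mc: "\<And>t. t \<in> {a..a+d} \<Longrightarrow> k t = m * t + c"
    using affine_between_breaks[OF PLc_continuous[OF k(1)], of a "a + d"] d by auto
  obtain m' c' where mc': "\<And>t. t \<in> {a..a+d} \<Longrightarrow> h t = m' * t + c'"
    using affine_between_breaks[OF PLc_continuous[OF h(1)], of a "a + d"] d by auto
  have close: "\<exists>n. (f ^^ n) z \<in> {a<..<a+d}" if "z \<in> {a<..<b}" for z
  proof -
    have "\<forall>\<^sub>F n in sequentially. (f ^^ n) z < a + d"
      using order_tendstoD(2)[OF it(2)[OF _ that]] d(1) by auto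
    then show ?thesis using it(1)[OF _ that] by (fastforce simp: eventually_sequentially)
  qed
  obtain n where n: "(f ^^ n) x \<in> {a<..<a+d}" using close[OF x(1)] by blast
  have "m * a + c = m' * a + c'" using a mc[of a] mc'[of a] d(1) by simp
  moreover have "m * (f ^^ n) x + c = m' * (f ^^ n) x + c'"
    using eq[of n] mc[of "(f ^^ n) x"] mc'[of "(f ^^ n) x"] n by simp
  ultimately have "(m - m') * ((f ^^ n) x - a) = 0" by (simp add: algebra_simps)
  then have "m = m'" using n by simp
  moreover have "c = c'" using \<open>m * a + c = m' * a + c'\<close> \<open>m = m'\<close> by simp
  ultimately have agree: "k t = h t" if "t \<in> {a..a+d}" for t using mc mc' that by simp
  obtain N where N: "(f ^^ N) y \<in> {a<..<a+d}" using close[OF y] by blast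
  have "(f ^^ N) (k y) = (f ^^ N) (h y)"
    using agree[of "(f ^^ N) y"] N commute_funpow[OF k(2)] commute_funpow[OF h(2)] by simp
  moreover have "inj (f ^^ N)" using bij_is_inj[OF PLc_bij[OF f(1)]] by (induction N) (auto intro: inj_compose)
  ultimately show ?thesis by (rule injD[rotated])
qed

lemma funpow_strict_mono_surj:
  assumes "f \<in> PLc"
  shows "strict_mono (f ^^ n)" "surj (f ^^ n)"
proof -
  show "strict_mono (f ^^ n)"
    by (induction n) (auto simp: strict_mono_def PLc_less[OF assms])
  show "surj (f ^^ n)" using PLc_surj[OF assms] by (rule surj_fn)
qed

text \<open>For large \<open>n\<close> the iterate \<open>f ^^ n\<close> squeezes most of a short interval below \<open>b\<close> into a
neighbourhood of \<open>a\<close> but stretches the remaining bit near \<open>b\<close>, so it has a break \<open>x\<close> close to \<open>b\<close>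
whose image is close to \<open>a\<close>. As \<open>k\<close> is affine both near \<open>x\<close> and near that image, and commutes with
the iterate, \<open>k x\<close> must be a break of the iterate too.\<close>

lemma commuting_maps_break_to_break:
  assumes f: "f \<in> PLc" "f a = a" "f b = b" and ab: "a < b"
    and dec: "\<And>y. y \<in> {a<..<b} \<Longrightarrow> f y < y"
    and k: "k \<in> PLc" "k \<circ> f = f \<circ> k"
  obtains n x where "x \<in> {a<..<b}" "x \<in> breaks (f ^^ n)" "k x \<in> breaks (f ^^ n)"
proof -
  note it = iterates_tendsto[OF f(1,2) dec]
  obtain d1 where d1: "d1 > 0" "breaks k \<inter> {a<..<a + d1} = {}"
    using finite_gap[OF PLc_finite_breaks[OF k(1)]] by metis
  obtain d2 where d2: "d2 > 0" "breaks k \<inter> {b - d2<..<b} = {}"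
    using finite_gap[OF PLc_finite_breaks[OF k(1)]] by metis
  define d where "d = min (min d1 d2) (b - a)"
  have d: "d > 0" "d \<le> b - a" "breaks k \<inter> {a<..<a + d} = {}" "breaks k \<inter> {b - d<..<b} = {}"
    using d1 d2 ab unfolding d_def by (auto simp: disjoint_iff)
  \<comment> \<open>If the iterate were affine between \<open>u\<close> and \<open>z\<close>, its slope would be less than 1 because of
      \<open>[u, w]\<close> and more than 1 because of \<open>[w, z]\<close>.\<close>
  define u w where "u = b - 3 * d / 4" and "w = b - d / 2"
  have uw: "u \<in> {a<..<b}" "w \<in> {a<..<b}" "w - u = d / 4" using d unfolding u_def w_def by auto
  obtain n where n: "(f ^^ n) w < a + d / 4"
    using order_tendstoD(2)[OF it(2)[OF _ uw(2)], of "a + d/4"] d(1)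
    by (auto simp: eventually_sequentially)
  note sm = funpow_strict_mono_surj[OF f(1), of n]
  let ?F = "f ^^ n"
  have Fa: "?F a = a" and Fb: "?F b = b" using f(2,3) by (induction n) auto
  define z where "z = fun_inv ?F (a + 3 * d / 4)"
  have Fz: "?F z = a + 3 * d / 4" unfolding z_def by (rule strict_mono_surj_inv(4)[OF sm])
  have less: "?F s < ?F t \<longleftrightarrow> s < t" for s t using sm(1) by (rule strict_mono_less)
  have "z < b" using less[of z b] Fb Fz d by simp
  have "w < z" using less[of w z] Fz n d(1) by simp
  have "\<not> breaks ?F \<inter> {u<..<z} = {}"
  proof
    assume nb: "breaks ?F \<inter> {u<..<z} = {}"
    obtain m c where mc: "\<And>t. t \<in> {u..z} \<Longrightarrow> ?F t = m * t + c"
      using affine_between_breaks[OF strict_mono_surj_continuous[OF sm] _ nb] \<open>w < z\<close> uw(3) d(1)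
      by auto
    have eqs: "?F u = m * u + c" "?F w = m * w + c" "?F z = m * z + c"
      using mc \<open>w < z\<close> uw(3) d(1) by auto
    have "a < ?F u" using less[of a u] Fa uw(1) by simp
    then have "m * (w - u) < d / 4" using eqs n by (simp add: algebra_simps)
    then have "m < 1" using d(1) unfolding uw(3) by simp
    have "m * (z - w) > d / 2" using eqs Fz n by (simp add: algebra_simps)
    moreover have "m * (z - w) \<le> z - w"
      using mult_right_mono[of m 1 "z - w"] \<open>m < 1\<close> \<open>w < z\<close> by simp
    ultimately show False using \<open>z < b\<close> unfolding w_def by simp
  qed
  then obtain x where x: "x \<in> breaks ?F" "u < x" "x < z" by auto
  have xab: "x \<in> {a<..<b}" using x uw(1) \<open>z < b\<close> by auto
  have kx: "affine_near k x"
    using d(4) x \<open>z < b\<close> d(1) unfolding breaks_def u_def by (auto simp: disjoint_iff)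
  have "?F x \<in> {a<..<a + d}"
    using less[of a x] less[of x z] Fa Fz x xab d(1) by auto
  then have kFx: "affine_near k (?F x)"
    using d(3) unfolding breaks_def by auto
  have "k x \<in> breaks ?F"
  proof (rule ccontr)
    assume "k x \<notin> breaks ?F"
    then have "affine_near (?F \<circ> k) x"
      using affine_near_comp[OF kx] by (simp add: breaks_def)
    moreover have "affine_near (fun_inv k) ((?F \<circ> k) x)"
      using affine_near_inv[OF PLc_strict_mono[OF k(1)] PLc_surj[OF k(1)] kFx]
      by (simp add: commute_funpow[OF k(2)])
    ultimately have "affine_near (fun_inv k \<circ> (?F \<circ> k)) x" by (rule affine_near_comp)
    moreover have "fun_inv k \<circ> (?F \<circ> k) = ?F"
    proof
      fix t show "(fun_inv k \<circ> (?F \<circ> k)) t = ?F t"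
        using commute_funpow[OF k(2), of n t, symmetric]
          strict_mono_surj_inv(3)[OF PLc_strict_mono[OF k(1)] PLc_surj[OF k(1)]] by simp
    qed
    ultimately show False using x(1) by (simp add: breaks_def)
  qed
  then show thesis using that xab x(1) by blast
qed

text \<open>A restriction is encoded by a pair consisting of a break of an iterate of \<open>f\<close> and its image,
which is again such a break.\<close>

lemma countable_restrictions_of_centralizer_decreasing:
  assumes f: "f \<in> PLc" "f a = a" "f b = b" and ab: "a < b"
    and dec: "\<And>y. y \<in> {a<..<b} \<Longrightarrow> f y < y"
  shows "countable ((\<lambda>k. restrict k {a<..<b}) ` {k \<in> PLc. k \<circ> f = f \<circ> k})"
proof -
  let ?K = "{k \<in> PLc. k \<circ> f = f \<circ> k}" and ?I = "{a<..<b}"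
  let ?R = "(\<lambda>k. restrict k ?I) ` ?K"
  define B where "B = (\<Union>n. breaks (f ^^ n))"
  have B: "countable B"
    unfolding B_def by (intro countable_UN countableI_type countable_finite PLc_funpow_breaks f)
  have "\<forall>r\<in>?R. \<exists>p. p \<in> B \<times> B \<and> fst p \<in> ?I \<and> r (fst p) = snd p"
  proof
    fix r assume "r \<in> ?R"
    then obtain k where k: "k \<in> PLc" "k \<circ> f = f \<circ> k" "r = restrict k ?I" by blast
    obtain n x where x: "x \<in> ?I" "x \<in> breaks (f ^^ n)" "k x \<in> breaks (f ^^ n)"
      by (rule commuting_maps_break_to_break[OF f ab dec k(1,2)])
    then have "(x, k x) \<in> B \<times> B" unfolding B_def by blast
    then show "\<exists>p. p \<in> B \<times> B \<and> fst p \<in> ?I \<and> r (fst p) = snd p"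
      using x(1) k(3) by (intro exI[of _ "(x, k x)"]) simp
  qed
  from bchoice[OF this] obtain p where
    "\<forall>r\<in>?R. p r \<in> B \<times> B \<and> fst (p r) \<in> ?I \<and> r (fst (p r)) = snd (p r)" ..
  then have p: "\<And>r. r \<in> ?R \<Longrightarrow> p r \<in> B \<times> B \<and> fst (p r) \<in> ?I \<and> r (fst (p r)) = snd (p r)"
    by (rule bspec)
  have "inj_on p ?R"
  proof (rule inj_onI)
    fix r s assume rs: "r \<in> ?R" "s \<in> ?R" "p r = p s"
    obtain k where k: "k \<in> PLc" "k \<circ> f = f \<circ> k" "r = restrict k ?I" using rs(1) by blast
    obtain h where h: "h \<in> PLc" "h \<circ> f = f \<circ> h" "s = restrict h ?I" using rs(2) by blast
    have x: "fst (p r) \<in> ?I" using p[OF rs(1)] by blast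
    have eq: "k (fst (p r)) = h (fst (p r))"
      using p[OF rs(1)] p[OF rs(2)] rs(3) fun_cong[OF k(3)] fun_cong[OF h(3)]
        restrict_apply'[OF x, of k] restrict_apply'[OF x, of h] by metis
    show "r = s" unfolding k(3) h(3)
      by (rule restrict_ext)
        (rule commuting_determined_by_one_value[OF f(1,2) dec k(1,2) h(1,2) x eq])
  qed
  moreover have "countable (p ` ?R)"
    using p by (intro countable_subset[of "p ` ?R" "B \<times> B"] countable_SIGMA B) blast
  ultimately show ?thesis by (simp add: countable_image_inj_eq)
qed

lemma no_fixed_point_sign:
  fixes f :: "real \<Rightarrow> real"
  assumes cont: "continuous_on UNIV f" and nofix: "\<And>y. y \<in> {a<..<b} \<Longrightarrow> f y \<noteq> y"
  shows "(\<forall>y\<in>{a<..<b}. f y < y) \<or> (\<forall>y\<in>{a<..<b}. y < f y)"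
proof (rule ccontr)
  assume "\<not> ?thesis"
  then obtain y z where y: "y \<in> {a<..<b}" "y < f y" and z: "z \<in> {a<..<b}" "f z < z"
    using nofix by (metis linorder_neqE_linordered_idom)
  have c: "continuous_on A (\<lambda>t. f t - t)" for A
    by (intro continuous_intros continuous_on_subset[OF cont]) simp
  have "\<exists>t. min y z \<le> t \<and> t \<le> max y z \<and> f t - t = 0"
  proof (cases "y \<le> z")
    case True
    then show ?thesis using IVT2'[of "\<lambda>t. f t - t" z 0 y, OF _ _ True c] y z by auto
  next
    case False
    then show ?thesis using IVT'[of "\<lambda>t. f t - t" z 0 y, OF _ _ _ c] y z by auto
  qed
  then obtain t where "min y z \<le> t" "t \<le> max y z" "f t = t" by auto
  moreover from this have "t \<in> {a<..<b}" using y(1) z(1) by (auto simp: min_def max_def split: if_splits)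
  ultimately show False using nofix by blast
qed

text \<open>The interval is the component of \<open>x\<close> in the set of moved points. There \<open>f\<close> or its inverse
decreases every point, and both have the same centralizer.\<close>

lemma countable_restrictions_of_centralizer:
  assumes f: "f \<in> PLc" and x: "x \<in> moved f"
  obtains a b where "x \<in> {a<..<b}"
    "countable ((\<lambda>k. restrict k {a<..<b}) ` {k \<in> PLc. k \<circ> f = f \<circ> k})"
proof -
  obtain M where M: "\<And>y. y \<in> moved f \<Longrightarrow> \<bar>y\<bar> \<le> M"
    using PLc_bounded[OF f] by (auto simp: bounded_iff)
  have fix_out: "f y = y" if "\<bar>y\<bar> > M" for y using M[of y] that by (auto simp: moved_def)
  define C where "C = {y. f y = y}"
  have C: "closed C"
    using open_moved[OF f] unfolding C_def moved_def closed_def by (simp add: Collect_neg_eq)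
  have lo: "- (M + 1) \<in> C \<inter> {..x}" and hi: "M + 1 \<in> C \<inter> {x..}"
    using fix_out[of "- (M + 1)"] fix_out[of "M + 1"] M[OF x] unfolding C_def by auto
  define a b where "a = Sup (C \<inter> {..x})" and "b = Inf (C \<inter> {x..})"
  have bdd: "bdd_above (C \<inter> {..x})" "bdd_below (C \<inter> {x..})" by auto
  have aC: "a \<in> C \<inter> {..x}"
    unfolding a_def using lo C bdd by (intro closed_contains_Sup closed_Int) auto
  have bC: "b \<in> C \<inter> {x..}"
    unfolding b_def using hi C bdd by (intro closed_contains_Inf closed_Int) auto
  have fab: "f a = a" "f b = b" using aC bC by (auto simp: C_def)
  have "x \<noteq> a" "x \<noteq> b" using x fab by (auto simp: moved_def)
  then have xab: "x \<in> {a<..<b}" using aC bC by auto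
  then have ab: "a < b" by auto
  have "y \<notin> C" if y: "y \<in> {a<..<b}" for y
  proof
    assume "y \<in> C"
    then show False
      using y cSup_upper[OF _ bdd(1), of y] cInf_lower[OF _ bdd(2), of y]
      unfolding a_def[symmetric] b_def[symmetric] by (cases "y \<le> x") auto
  qed
  then have nofix: "\<And>y. y \<in> {a<..<b} \<Longrightarrow> f y \<noteq> y" by (auto simp: C_def)
  consider "\<forall>y\<in>{a<..<b}. f y < y" | "\<forall>y\<in>{a<..<b}. y < f y"
    using no_fixed_point_sign[OF PLc_continuous[OF f] nofix] by blast
  then have "countable ((\<lambda>k. restrict k {a<..<b}) ` {k \<in> PLc. k \<circ> f = f \<circ> k})"
  proof cases
    case 1
    then show ?thesis
      using countable_restrictions_of_centralizer_decreasing[OF f fab ab] by blast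
  next
    case 2
    let ?g = "fun_inv f"
    note i = strict_mono_surj_inv[OF PLc_strict_mono[OF f] PLc_surj[OF f]]
    have g: "?g \<in> PLc" by (rule PLc_inv[OF f])
    have gab: "?g a = a" "?g b = b" using i(3)[of a] i(3)[of b] fab by simp_all
    have "?g y < y" if "y \<in> {a<..<b}" for y
      using 2 that i(4)[of y] PLc_less[OF f, of "?g y" y] by simp
    then have cnt: "countable ((\<lambda>k. restrict k {a<..<b}) ` {k \<in> PLc. k \<circ> ?g = ?g \<circ> k})"
      using countable_restrictions_of_centralizer_decreasing[OF g gab ab] by blast
    have "k \<circ> ?g = ?g \<circ> k" if "k \<circ> f = f \<circ> k" for k
    proof
      fix t
      have "f (k (?g t)) = k t" using fun_cong[OF that, of "?g t"] i(4)[of t] by simp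
      then show "(k \<circ> ?g) t = (?g \<circ> k) t" using i(3)[of "k (?g t)"] by simp
    qed
    then show ?thesis by (intro countable_subset[OF _ cnt] image_mono) blast
  qed
  then show thesis using that xab by blast
qed

section \<open>Groups with countably many commutators\<close>

text \<open>Choosing one representative \<open>r z\<close> for each commutator \<open>z\<close> with \<open>f\<close>, every element of the group
is a representative composed with a map commuting with \<open>f\<close>.\<close>

lemma countable_restrictions_if_countable_commutators:
  assumes G: "G \<subseteq> PLc" "\<And>g h. g \<in> G \<Longrightarrow> h \<in> G \<Longrightarrow> g \<circ> h \<in> G" "\<And>g. g \<in> G \<Longrightarrow> fun_inv g \<in> G"
    and comm: "countable ((\<lambda>(g, h). g \<circ> h \<circ> fun_inv g \<circ> fun_inv h) ` (G \<times> G))"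
    and f: "f \<in> G" and x: "x \<in> moved f"
  obtains a b where "x \<in> {a<..<b}" "countable ((\<lambda>g. restrict g {a<..<b}) ` G)"
proof -
  let ?K = "{k \<in> PLc. k \<circ> f = f \<circ> k}"
  define c where "c = (\<lambda>g. g \<circ> f \<circ> fun_inv g \<circ> fun_inv f)"
  have "c ` G \<subseteq> (\<lambda>(g, h). g \<circ> h \<circ> fun_inv g \<circ> fun_inv h) ` (G \<times> G)"
    using f unfolding c_def by force
  then have cG: "countable (c ` G)" using comm countable_subset by blast
  have fP: "f \<in> PLc" using f G(1) by blast
  obtain a b where ab: "x \<in> {a<..<b}" and cnt: "countable ((\<lambda>k. restrict k {a<..<b}) ` ?K)"
    by (rule countable_restrictions_of_centralizer[OF fP x])
  let ?I = "{a<..<b}"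
  define r where "r = inv_into G c"
  have r: "r z \<in> G" "c (r z) = z" if "z \<in> c ` G" for z
    using that unfolding r_def by (rule inv_into_into, rule f_inv_into_f)
  have "restrict g ?I \<in> (\<lambda>(z, s). restrict (r z \<circ> s) ?I) ` (c ` G \<times> (\<lambda>k. restrict k ?I) ` ?K)"
    if g: "g \<in> G" for g
  proof -
    let ?h = "r (c g)"
    have h: "?h \<in> G" "c ?h = c g" using r g by auto
    let ?k = "fun_inv ?h \<circ> g"
    have hP: "?h \<in> PLc" and gP: "g \<in> PLc" using h(1) g G(1) by auto
    note ih = strict_mono_surj_inv[OF PLc_strict_mono[OF hP] PLc_surj[OF hP]]
    note ig = strict_mono_surj_inv[OF PLc_strict_mono[OF gP] PLc_surj[OF gP]]
    note jf = strict_mono_surj_inv[OF PLc_strict_mono[OF fP] PLc_surj[OF fP]]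
    have "?k \<circ> f = f \<circ> ?k"
    proof
      fix t
      have "?h (f (fun_inv ?h (g t))) = g (f t)"
        using fun_cong[OF h(2), of "f (g t)"] by (simp add: c_def ig(3) jf(3))
      then show "(?k \<circ> f) t = (f \<circ> ?k) t" using ih(3)[of "f (fun_inv ?h (g t))"] by simp
    qed
    moreover have "?k \<in> PLc" using G g h(1) by blast
    ultimately have "restrict ?k ?I \<in> (\<lambda>k. restrict k ?I) ` ?K" by blast
    moreover have "restrict g ?I = restrict (?h \<circ> restrict ?k ?I) ?I"
      by (rule restrict_ext) (simp add: ih(4))
    ultimately show ?thesis using g by (intro image_eqI[of _ _ "(c g, restrict ?k ?I)"]) auto
  qed
  then have "(\<lambda>g. restrict g ?I) ` G
      \<subseteq> (\<lambda>(z, s). restrict (r z \<circ> s) ?I) ` (c ` G \<times> (\<lambda>k. restrict k ?I) ` ?K)" by blast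
  then have "countable ((\<lambda>g. restrict g ?I) ` G)"
    by (rule countable_subset) (intro countable_image countable_SIGMA cG cnt)
  then show thesis using that ab by blast
qed

text \<open>A rational number chosen inside the adjacent interval tells the end points apart: a larger end
point cannot lie in the interval adjacent to a smaller one.\<close>

lemma countable_right_sided_ends:
  fixes U :: "real set"
  shows "countable {x. x \<notin> U \<and> (\<exists>d>0. {x<..<x + d} \<subseteq> U)}" (is "countable ?R")
proof -
  have "\<forall>x\<in>?R. \<exists>q. q \<in> \<rat> \<and> x < q \<and> {x<..q} \<subseteq> U"
  proof
    fix x assume "x \<in> ?R"
    then obtain d where "d > 0" "{x<..<x + d} \<subseteq> U" by blast
    moreover obtain q where "q \<in> \<rat>" "x < q" "q < x + d"
      using Rats_dense_in_real[of x "x + d"] \<open>d > 0\<close> by auto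
    ultimately show "\<exists>q. q \<in> \<rat> \<and> x < q \<and> {x<..q} \<subseteq> U" by (intro exI[of _ q]) auto
  qed
  from bchoice[OF this] obtain q where "\<forall>x\<in>?R. q x \<in> \<rat> \<and> x < q x \<and> {x<..q x} \<subseteq> U" ..
  then have q: "\<And>x. x \<in> ?R \<Longrightarrow> q x \<in> \<rat> \<and> x < q x \<and> {x<..q x} \<subseteq> U" by (rule bspec)
  have "inj_on q ?R"
  proof (rule linorder_inj_onI')
    fix x y assume xy: "x \<in> ?R" "y \<in> ?R" "x < y"
    show "q x \<noteq> q y"
    proof
      assume "q x = q y"
      then have "y \<in> {x<..q x}" using q[OF xy(2)] xy(3) by simp
      then show False using q[OF xy(1)] xy(2) by blast
    qed
  qed
  moreover have "countable (q ` ?R)" using q by (intro countable_subset[OF _ countable_rat]) blast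
  ultimately show ?thesis by (simp only: countable_image_inj_eq)
qed

lemma countable_one_sided_ends:
  fixes U :: "real set"
  shows "countable {x. x \<notin> U \<and> (\<exists>d>0. {x<..<x + d} \<subseteq> U \<or> {x - d<..<x} \<subseteq> U)}"
proof -
  let ?R = "\<lambda>U::real set. {x. x \<notin> U \<and> (\<exists>d>0. {x<..<x + d} \<subseteq> U)}"
  have mirror: "- x \<in> ?R (uminus ` U)" if x: "x \<notin> U" and d: "d > 0" "{x - d<..<x} \<subseteq> U" for x d
  proof -
    have "t \<in> uminus ` U" if "t \<in> {- x<..<- x + d}" for t
      using that d(2) by (intro image_eqI[of _ _ "- t"]) auto
    then show ?thesis using x d(1) by auto
  qed
  then have "{x. x \<notin> U \<and> (\<exists>d>0. {x<..<x + d} \<subseteq> U \<or> {x - d<..<x} \<subseteq> U)}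
      \<subseteq> ?R U \<union> uminus ` ?R (uminus ` U)"
  proof (intro subsetI)
    fix x assume "x \<in> {x. x \<notin> U \<and> (\<exists>d>0. {x<..<x + d} \<subseteq> U \<or> {x - d<..<x} \<subseteq> U)}"
    then consider "x \<in> ?R U" | d where "x \<notin> U" "d > 0" "{x - d<..<x} \<subseteq> U" by blast
    then show "x \<in> ?R U \<union> uminus ` ?R (uminus ` U)"
    proof cases
      case 2
      then have "- x \<in> ?R (uminus ` U)"
        by (rule mirror)
      then have "- (- x) \<in> uminus ` ?R (uminus ` U)" by (rule imageI)
      then show ?thesis unfolding minus_minus by (rule UnI2)
    qed (rule UnI1)
  qed
  then show ?thesis
    by (rule countable_subset) (intro countable_Un countable_image countable_right_sided_ends)
qed

text \<open>At a fixed point the germ on either side is \<open>t \<mapsto> x + m (t - x)\<close>. If both slopes are 1 there is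
no break, and a slope other than 1 moves every point on its side.\<close>

lemma fixed_break_is_end_of_moved:
  assumes g: "g \<in> PLc" and x: "x \<in> breaks g" "x \<notin> moved g"
  shows "\<exists>d>0. {x<..<x + d} \<subseteq> moved g \<or> {x - d<..<x} \<subseteq> moved g"
proof -
  have gx: "g x = x" using x(2) by (simp add: moved_def)
  obtain d where d: "d > 0" "breaks g \<inter> {x<..<x + d} = {}" "breaks g \<inter> {x - d<..<x} = {}"
    using finite_gap[OF PLc_finite_breaks[OF g]] by metis
  obtain m c where mc: "\<And>t. t \<in> {x..x+d} \<Longrightarrow> g t = m * t + c"
    using affine_between_breaks[OF PLc_continuous[OF g] _ d(2)] d(1) by auto
  obtain m' c' where mc': "\<And>t. t \<in> {x-d..x} \<Longrightarrow> g t = m' * t + c'"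
    using affine_between_breaks[OF PLc_continuous[OF g] _ d(3)] d(1) by auto
  have r: "g t - t = (m - 1) * (t - x)" if "t \<in> {x..x+d}" for t
    using mc[OF that] mc[of x] gx d(1) by (simp add: algebra_simps)
  have l: "g t - t = (m' - 1) * (t - x)" if "t \<in> {x-d..x}" for t
    using mc'[OF that] mc'[of x] gx d(1) by (simp add: algebra_simps)
  show ?thesis
  proof (cases "m = 1 \<and> m' = 1")
    case True
    have "g t = 1 * t + 0" if "dist t x < d" for t
    proof (cases "t \<le> x")
      case True
      then show ?thesis using l[of t] that \<open>m = 1 \<and> m' = 1\<close> by (simp add: dist_real_def)
    next
      case False
      then show ?thesis using r[of t] that \<open>m = 1 \<and> m' = 1\<close> by (simp add: dist_real_def)
    qed
    then have "\<forall>\<^sub>F t in nhds x. g t = 1 * t + 0"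
      using d(1) unfolding eventually_nhds_metric by blast
    then have "affine_near g x" unfolding affine_near_def by blast
    then show ?thesis using x(1) by (simp add: breaks_def)
  next
    case False
    have "{x<..<x + d} \<subseteq> moved g" if "m \<noteq> 1"
    proof
      fix t assume "t \<in> {x<..<x + d}"
      then show "t \<in> moved g" using r[of t] that by (auto simp: moved_def)
    qed
    moreover have "{x - d<..<x} \<subseteq> moved g" if "m' \<noteq> 1"
    proof
      fix t assume "t \<in> {x - d<..<x}"
      then show "t \<in> moved g" using l[of t] that by (auto simp: moved_def)
    qed
    ultimately show ?thesis using False d(1) by blast
  qed
qed

text \<open>The two functions agree at the breaks and far out, and are affine in between.\<close>

lemma PLc_eqI_breaks:
  assumes g: "g \<in> PLc" and h: "h \<in> PLc"
    and br: "breaks g = breaks h" and eq: "\<And>x. x \<in> breaks g \<Longrightarrow> g x = h x"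
  shows "g = h"
proof
  fix x
  obtain M where M: "\<And>y. y \<in> moved g \<union> moved h \<Longrightarrow> \<bar>y\<bar> \<le> M"
    using PLc_bounded[OF g] PLc_bounded[OF h] bounded_Un[of "moved g" "moved h"]
    by (auto simp: bounded_iff)
  define N where "N = max M \<bar>x\<bar> + 1"
  have N: "M < N" "\<bar>x\<bar> < N" unfolding N_def by auto
  \<comment> \<open>The points \<open>N\<close> and \<open>-N\<close> lie outside both supports and serve as the outermost
      interpolation points.\<close>
  have out: "g y = h y" if "\<bar>y\<bar> = N" for y
  proof -
    have "y \<notin> moved g \<union> moved h" using M[of y] N(1) that by linarith
    then show ?thesis by (simp add: moved_def)
  qed
  define S where "S = breaks g \<union> {-N, N}"
  have S: "finite S" "\<And>y. y \<in> S \<Longrightarrow> g y = h y"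
    using PLc_finite_breaks[OF g] eq out N(2) unfolding S_def by auto
  show "g x = h x"
  proof (cases "x \<in> S")
    case False
    define u v where "u = Max {s \<in> S. s < x}" and "v = Min {s \<in> S. x < s}"
    have fin: "finite {s \<in> S. s < x}" "finite {s \<in> S. x < s}" using S(1) by auto
    have ne: "{s \<in> S. s < x} \<noteq> {}" "{s \<in> S. x < s} \<noteq> {}"
      using N(2) unfolding S_def by auto
    have u: "u \<in> S" "u < x" using Max_in[OF fin(1) ne(1)] unfolding u_def by auto
    have v: "v \<in> S" "x < v" using Min_in[OF fin(2) ne(2)] unfolding v_def by auto
    have gap: "s \<notin> S" if "s \<in> {u<..<v}" for s
    proof
      assume "s \<in> S"
      then have "s \<noteq> x" using False by blast
      then show False
        using \<open>s \<in> S\<close> that Max_ge[OF fin(1), of s] Min_le[OF fin(2), of s]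
        unfolding u_def[symmetric] v_def[symmetric] by force
    qed
    have nb: "breaks g \<inter> {u<..<v} = {}" "breaks h \<inter> {u<..<v} = {}"
      using gap br unfolding S_def by auto
    have uv: "u < v" using u v by simp
    obtain m c where mc: "\<And>t. t \<in> {u..v} \<Longrightarrow> g t = m * t + c"
      using affine_between_breaks[OF PLc_continuous[OF g] uv nb(1)] by blast
    obtain m' c' where mc': "\<And>t. t \<in> {u..v} \<Longrightarrow> h t = m' * t + c'"
      using affine_between_breaks[OF PLc_continuous[OF h] uv nb(2)] by blast
    have e: "m * u + c = m' * u + c'" "m * v + c = m' * v + c'"
      using S(2)[OF u(1)] S(2)[OF v(1)] mc[of u] mc[of v] mc'[of u] mc'[of v] uv by auto
    then have "(m - m') * (v - u) = 0" by (simp add: algebra_simps)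
    then have "m = m'" using uv by simp
    then show ?thesis using e mc[of x] mc'[of x] u v by simp
  qed (rule S(2))
qed

lemma breaks_restrict:
  assumes "open I"
  shows "breaks (restrict g I) \<inter> I = breaks g \<inter> I"
proof -
  have "affine_near (restrict g I) x \<longleftrightarrow> affine_near g x" if "x \<in> I" for x
  proof -
    have "\<forall>\<^sub>F t in nhds x. restrict g I t = g t"
      using assms that unfolding eventually_nhds by (intro exI[of _ I]) simp
    then show ?thesis
      using affine_near_cong[of "restrict g I" g x] affine_near_cong[of g "restrict g I" x]
      by (metis (mono_tags, lifting) eventually_mono)
  qed
  then show ?thesis unfolding breaks_def by blast
qed

text \<open>Elements are encoded by the finite graph over their breaks. The graphs are finite subsets of a
countable set because the breaks of all elements together form a countable set and every point has
a countable orbit. Both are local statements on the open set \<open>U\<close> covered by intervals with countably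
many restrictions; off \<open>U\<close> every point is fixed and a break is an end of an interval inside \<open>U\<close>.\<close>

theorem countable_if_countable_commutators:
  assumes G: "G \<subseteq> PLc" "\<And>g h. g \<in> G \<Longrightarrow> h \<in> G \<Longrightarrow> g \<circ> h \<in> G" "\<And>g. g \<in> G \<Longrightarrow> fun_inv g \<in> G"
    and comm: "countable ((\<lambda>(g, h). g \<circ> h \<circ> fun_inv g \<circ> fun_inv h) ` (G \<times> G))"
  shows "countable G"
proof -
  define \<I> where "\<I> = {I. open I \<and> countable ((\<lambda>g. restrict g I) ` G)}"
  obtain \<J> where J: "\<J> \<subseteq> \<I>" "countable \<J>" "\<Union>\<J> = \<Union>\<I>"
    using Lindelof[of \<I>] unfolding \<I>_def by (metis (mono_tags, lifting) mem_Collect_eq)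
  define U where "U = \<Union>\<J>"
  have moved_U: "moved g \<subseteq> U" if g: "g \<in> G" for g
  proof
    fix x assume "x \<in> moved g"
    then obtain a b where "x \<in> {a<..<b}" "countable ((\<lambda>g. restrict g {a<..<b}) ` G)"
      using countable_restrictions_if_countable_commutators[OF G comm g] by blast
    then have "{a<..<b} \<in> \<I>" by (simp add: \<I>_def)
    then show "x \<in> U" using \<open>x \<in> {a<..<b}\<close> unfolding U_def J(3) by blast
  qed
  let ?E = "{x. x \<notin> U \<and> (\<exists>d>0. {x<..<x + d} \<subseteq> U \<or> {x - d<..<x} \<subseteq> U)}"
  define B where "B = (\<Union>I\<in>\<J>. \<Union>r\<in>(\<lambda>g. restrict g I) ` G. breaks r \<inter> I) \<union> ?E"
  have "countable (breaks r \<inter> I)" if I: "I \<in> \<J>" and r: "r \<in> (\<lambda>g. restrict g I) ` G" for r I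
  proof -
    obtain g where g: "g \<in> G" "r = restrict g I" using r by blast
    have "open I" using I J(1) by (auto simp: \<I>_def)
    then have "breaks r \<inter> I = breaks g \<inter> I" using g(2) breaks_restrict by blast
    then show ?thesis using PLc_finite_breaks[of g] g(1) G(1) by (auto intro: countable_finite)
  qed
  then have B: "countable B"
    unfolding B_def using J(1,2)
    by (intro countable_Un countable_UN countable_one_sided_ends) (auto simp: \<I>_def)
  have breaks_B: "breaks g \<subseteq> B" if g: "g \<in> G" for g
  proof
    fix x assume x: "x \<in> breaks g"
    show "x \<in> B"
    proof (cases "x \<in> U")
      case True
      then obtain I where I: "I \<in> \<J>" "x \<in> I" unfolding U_def by blast
      then have "open I" using J(1) by (auto simp: \<I>_def)
      then have "x \<in> breaks (restrict g I) \<inter> I" using x I(2) breaks_restrict by blast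
      then show ?thesis using I(1) g unfolding B_def by blast
    next
      case False
      then have "x \<notin> moved g" using moved_U[OF g] by blast
      then have "\<exists>d>0. {x<..<x + d} \<subseteq> moved g \<or> {x - d<..<x} \<subseteq> moved g"
        using fixed_break_is_end_of_moved x g G(1) by blast
      then have "x \<in> ?E" using False moved_U[OF g] by blast
      then show ?thesis unfolding B_def by blast
    qed
  qed
  have val: "countable ((\<lambda>g. g x) ` G)" for x
  proof (cases "x \<in> U")
    case True
    then obtain I where I: "I \<in> \<J>" "x \<in> I" unfolding U_def by blast
    have "(\<lambda>g. g x) ` G = (\<lambda>r. r x) ` (\<lambda>g. restrict g I) ` G"
      using I(2) by (simp add: image_image)
    then show ?thesis using I(1) J(1) by (auto simp: \<I>_def)
  next
    case False
    then have "(\<lambda>g. g x) ` G \<subseteq> {x}" using moved_U by (auto simp: moved_def)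
    then show ?thesis by (rule countable_subset) simp
  qed
  define T where "T = Sigma B (\<lambda>x. (\<lambda>g. g x) ` G)"
  have T: "countable T" unfolding T_def by (intro countable_SIGMA B val)
  define graph where "graph = (\<lambda>g::real \<Rightarrow> real. (\<lambda>x. (x, g x)) ` breaks g)"
  have "graph ` G \<subseteq> {A. finite A \<and> A \<subseteq> T}"
  proof (rule image_subsetI)
    fix g assume g: "g \<in> G"
    have "finite (graph g)"
      using PLc_finite_breaks[of g] g G(1) unfolding graph_def by (auto intro: finite_imageI)
    moreover have "graph g \<subseteq> T"
      unfolding graph_def T_def using breaks_B[OF g] g
      by (intro image_subsetI SigmaI) (auto intro: imageI)
    ultimately show "graph g \<in> {A. finite A \<and> A \<subseteq> T}" by (intro CollectI conjI)
  qed
  then have "countable (graph ` G)"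
    by (rule countable_subset) (rule countable_Collect_finite_subset[OF T])
  moreover have "inj_on graph G"
  proof (rule inj_onI)
    fix g h assume gh: "g \<in> G" "h \<in> G" "graph g = graph h"
    have "fst ` graph g = breaks g" for g unfolding graph_def by (simp add: image_image)
    then have "breaks g = breaks h" using gh(3) by metis
    moreover have "g x = h x" if "x \<in> breaks g" for x
    proof -
      have "(x, g x) \<in> graph h" using that gh(3) unfolding graph_def by blast
      then show ?thesis unfolding graph_def by auto
    qed
    ultimately show "g = h" using PLc_eqI_breaks gh(1,2) G(1) by blast
  qed
  ultimately show ?thesis by (simp only: countable_image_inj_eq)
qed

section \<open>Transfer to the unit interval\<close>

text \<open>Elements of the group are undefined outside the unit interval; the identity
continues them to homeomorphisms of the line.\<close>

definition extend_id :: "(real \<Rightarrow> real) \<Rightarrow> real \<Rightarrow> real" where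
  "extend_id f = (\<lambda>x. if x \<in> {0..1} then f x else x)"

lemma carrier_PLo: "carrier PLo = PLo_homeos"
  by (simp add: PLo_def)

lemma PLo_homeos_maps: "f \<in> PLo_homeos \<Longrightarrow> f ` {0..1} = {0..1}"
  using PLo_homeos_subset_Bij by (auto simp: Bij_def bij_betw_def)

lemma extend_id_mult:
  assumes "f \<in> PLo_homeos" "g \<in> PLo_homeos"
  shows "extend_id (f \<otimes>\<^bsub>PLo\<^esub> g) = extend_id f \<circ> extend_id g"
proof
  fix x
  have "f \<otimes>\<^bsub>PLo\<^esub> g = compose {0..1} f g"
    using assms PLo_homeos_subset_Bij by (auto simp: PLo_def BijGroup_def subset_iff)
  moreover have "g x \<in> {0..1}" if "x \<in> {0..1}"
    using PLo_homeos_maps[OF assms(2)] that by blast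
  ultimately show "extend_id (f \<otimes>\<^bsub>PLo\<^esub> g) x = (extend_id f \<circ> extend_id g) x"
    by (auto simp: extend_id_def compose_def)
qed

lemma extend_id_one: "extend_id \<one>\<^bsub>PLo\<^esub> = id"
  by (auto simp: PLo_def BijGroup_def extend_id_def)

text \<open>New breaks can only appear at the end points 0 and 1.\<close>

lemma extend_id_PLc:
  assumes f: "f \<in> PLo_homeos"
  shows "extend_id f \<in> PLc"
proof -
  have sm: "strict_mono_on {0..1} f" and pl: "piecewise_linear 0 1 f"
    using f by (auto simp: PLo_homeos_def)
  note im = PLo_homeos_maps[OF f]
  have "strict_mono (extend_id f)"
  proof (rule strict_monoI)
    fix x y :: real assume "x < y"
    moreover have "t \<in> {0..1} \<Longrightarrow> f t \<in> {0..1}" for t using im by blast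
    ultimately show "extend_id f x < extend_id f y"
      using strict_mono_onD[OF sm, of x y] unfolding extend_id_def by fastforce
  qed
  moreover have "surj (extend_id f)"
  proof -
    have "y \<in> range (extend_id f)" for y
    proof (cases "y \<in> {0..1}")
      case True
      then obtain t where "t \<in> {0..1}" "y = f t" using im by blast
      then have "extend_id f t = y" by (simp add: extend_id_def)
      then show ?thesis by blast
    next
      case False
      then have "extend_id f y = y" by (auto simp: extend_id_def)
      then show ?thesis by (metis rangeI)
    qed
    then show ?thesis by blast
  qed
  moreover have "finite (breaks (extend_id f))"
  proof -
    obtain B where B: "finite B" "\<And>x y. \<lbrakk>0 \<le> x; x \<le> y; y \<le> 1; {x<..<y} \<inter> B = {}\<rbrakk>
      \<Longrightarrow> \<exists>a b. \<forall>t\<in>{x..y}. f t = a * t + b"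
      by (rule piecewise_linearE[OF pl]) (rule that; blast)
    have "affine_near (extend_id f) x" if x: "x \<notin> insert 0 (insert 1 B)" for x
    proof -
      have "open (- insert 0 (insert 1 B))" using B(1) by (intro open_Compl finite_imp_closed) simp
      then obtain e where e: "e > 0" "cball x e \<subseteq> - insert 0 (insert 1 B)"
        using x by (metis ComplI open_contains_cball)
      have avoid: "t \<notin> insert 0 (insert 1 B)" if "t \<in> {x-e..x+e}" for t
        using e(2) that by (auto simp: cball_eq_atLeastAtMost subset_iff)
      have "\<exists>a b. \<forall>t\<in>{x-e..x+e}. extend_id f t = a * t + b"
      proof (cases "x \<in> {0..1}")
        case True
        have "0 \<le> x - e" by (rule ccontr) (use True avoid[of 0] e(1) in auto)
        moreover have "x + e \<le> 1" by (rule ccontr) (use True avoid[of 1] e(1) in auto)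
        ultimately have sub: "0 \<le> x - e" "x + e \<le> 1" .
        then have "\<exists>a b. \<forall>t\<in>{x-e..x+e}. f t = a * t + b"
          using avoid e(1) by (intro B(2)) auto
        then show ?thesis using sub by (simp add: extend_id_def)
      next
        case False
        then have "t \<notin> {0..1}" if "t \<in> {x-e..x+e}" for t
          using avoid[of 0] avoid[of 1] e(1) that by auto
        then have "\<forall>t\<in>{x-e..x+e}. extend_id f t = 1 * t + 0" by (auto simp: extend_id_def)
        then show ?thesis by blast
      qed
      then obtain a b where ab: "\<And>t. t \<in> {x-e..x+e} \<Longrightarrow> extend_id f t = a * t + b" by blast
      have "\<forall>t. dist t x < e \<longrightarrow> extend_id f t = a * t + b"
        using ab by (auto simp: dist_real_def abs_less_iff)
      then show ?thesis unfolding affine_near_def eventually_nhds_metric using e(1) by blast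
    qed
    then have "breaks (extend_id f) \<subseteq> insert 0 (insert 1 B)" unfolding breaks_def by blast
    then show ?thesis using B(1) finite_subset by blast
  qed
  moreover have "bounded (moved (extend_id f))"
    by (rule bounded_subset[of "{0..1}"]) (auto simp: moved_def extend_id_def)
  ultimately show ?thesis by (simp add: PLc_def)
qed

lemma inj_on_extend_id: "inj_on extend_id PLo_homeos"
proof (rule inj_onI)
  fix f g assume fg: "f \<in> PLo_homeos" "g \<in> PLo_homeos" "extend_id f = extend_id g"
  show "f = g"
  proof (rule extensionalityI[of _ "{0..1}"])
    fix x :: real assume "x \<in> {0..1}"
    then show "f x = g x" using fun_cong[OF fg(3), of x] by (simp add: extend_id_def)
  qed (use fg in \<open>auto simp: PLo_homeos_def\<close>)
qed

lemma extend_id_inv: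
  assumes f: "f \<in> PLo_homeos"
  shows "extend_id (inv\<^bsub>PLo\<^esub> f) = fun_inv (extend_id f)"
proof
  fix x
  interpret group PLo by (rule group_PLo)
  have f': "f \<in> carrier PLo" using f by (simp add: carrier_PLo)
  have "inv\<^bsub>PLo\<^esub> f \<in> PLo_homeos" using inv_closed[OF f'] by (simp add: carrier_PLo)
  then have "extend_id f \<circ> extend_id (inv\<^bsub>PLo\<^esub> f) = id"
    using extend_id_mult[OF f] r_inv[OF f'] extend_id_one by metis
  then have "extend_id f (extend_id (inv\<^bsub>PLo\<^esub> f) x) = x" by (metis comp_apply id_apply)
  then show "extend_id (inv\<^bsub>PLo\<^esub> f) x = fun_inv (extend_id f) x"
    using PLc_bij[OF extend_id_PLc[OF f]] by (metis bij_inv_eq_iff)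
qed

text \<open>The derived subgroup contains all commutators, and \<open>extend_id\<close> is an injective homomorphism.\<close>

lemma countable_if_countable_derived:
  assumes K: "subgroup K PLo" and der: "countable (derived PLo K)"
  shows "countable K"
proof -
  interpret group PLo by (rule group_PLo)
  have KP: "K \<subseteq> PLo_homeos" using subgroup.subset[OF K] by (simp add: carrier_PLo)
  have closed: "f \<otimes>\<^bsub>PLo\<^esub> g \<in> K" "inv\<^bsub>PLo\<^esub> f \<in> K" if "f \<in> K" "g \<in> K" for f g
    using K that by (auto intro: subgroup.m_closed subgroup.m_inv_closed)
  have "countable (extend_id ` K)"
  proof (rule countable_if_countable_commutators)
    show "extend_id ` K \<subseteq> PLc" using KP extend_id_PLc by blast
    show "g \<circ> h \<in> extend_id ` K" if gh: "g \<in> extend_id ` K" "h \<in> extend_id ` K" for g h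
    proof -
      obtain f f' where "f \<in> K" "f' \<in> K" "g = extend_id f" "h = extend_id f'" using gh by blast
      then show ?thesis using extend_id_mult closed(1) KP by (metis imageI subsetD)
    qed
    show "fun_inv g \<in> extend_id ` K" if g: "g \<in> extend_id ` K" for g
    proof -
      obtain f where "f \<in> K" "g = extend_id f" using g by blast
      then show ?thesis using extend_id_inv closed(2) KP by (metis imageI subsetD)
    qed
    have "extend_id g \<circ> extend_id h \<circ> fun_inv (extend_id g) \<circ> fun_inv (extend_id h)
        \<in> extend_id ` derived PLo K" if gh: "g \<in> K" "h \<in> K" for g h
    proof -
      let ?c = "g \<otimes>\<^bsub>PLo\<^esub> h \<otimes>\<^bsub>PLo\<^esub> inv\<^bsub>PLo\<^esub> g \<otimes>\<^bsub>PLo\<^esub> inv\<^bsub>PLo\<^esub> h"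
      have "?c \<in> derived_set PLo K" using gh by blast
      then have "?c \<in> derived PLo K" unfolding derived_def by (rule generate.incl)
      moreover have "extend_id ?c = extend_id g \<circ> extend_id h \<circ> fun_inv (extend_id g) \<circ> fun_inv (extend_id h)"
        using gh closed KP by (simp add: extend_id_mult extend_id_inv subset_iff)
      ultimately show ?thesis by (metis imageI)
    qed
    then have "(\<lambda>(g, h). g \<circ> h \<circ> fun_inv g \<circ> fun_inv h) ` (extend_id ` K \<times> extend_id ` K)
        \<subseteq> extend_id ` derived PLo K" by auto
    then show "countable ((\<lambda>(g, h). g \<circ> h \<circ> fun_inv g \<circ> fun_inv h) ` (extend_id ` K \<times> extend_id ` K))"
      by (rule countable_subset) (rule countable_image[OF der])
  qed
  moreover have "inj_on extend_id K" using inj_on_extend_id KP by (rule inj_on_subset)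
  ultimately show ?thesis by (simp only: countable_image_inj_eq)
qed

theorem corollary1p4:
  fixes H :: "(real \<Rightarrow> real) set"
  assumes "subgroup H PLo"
    and "solvable (PLo \<lparr>carrier := H\<rparr>)"
  shows "countable H"
proof -
  interpret group PLo by (rule group_PLo)
  let ?L = "PLo \<lparr>carrier := H\<rparr>"
  interpret L: group ?L by (rule subgroup_imp_group[OF assms(1)])
  obtain n where n: "(derived ?L ^^ n) H = {\<one>\<^bsub>?L\<^esub>}"
    using assms(2) L.solvable_iff_trivial_derived_seq by auto
  have same: "(derived ?L ^^ i) H = (derived PLo ^^ i) H \<and> (derived ?L ^^ i) H \<subseteq> H" for i
  proof (induction i)
    case (Suc i)
    have "(derived PLo ^^ i) H \<subseteq> H" using conjunct2[OF Suc] unfolding conjunct1[OF Suc] .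
    then show ?case
      using Suc derived_consistent[OF _ assms(1)] derived_incl[OF _ assms(1)] by simp
  qed simp
  have "countable ((derived PLo ^^ n) H)" using n same[of n] by simp
  then show ?thesis
  proof (induction n)
    case (Suc i)
    then show ?case
      using countable_if_countable_derived[OF exp_of_derived_is_subgroup[OF assms(1), of i]] by simp
  qed simp
qed

end
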